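(* Let $0<\varepsilon\le\frac12$. For positive integers $r$ with $r=O(n^{1/2-\varepsilon})$, the number $Z_n$ of zeros of a random lattice path $P_n$ of length $n$ (chosen according to the model in the context) satisfies $$\mathbb{P}(Z_n=r)=\frac{1}{r(r+1)}\left(1+O\bigl(1/n^{2\varepsilon}\bigr)\right)$$ asymptotically as $n\to\infty$.
   Context: Random path model: for an integer $n\ge0$, a random path $P_n$ on the lattice $\mathbb{Z}^2$ with steps $(1,+1)$ and $(1,-1)$, ending in $(n,0)$, is chosen as follows. First choose a starting point $(0,S)$ with $S$ uniformly distributed in $\{-n,-n+2,\dots,n-2,n\}$. Then choose a path uniformly at random among all paths from $(0,S)$ to $(n,0)$. A zero of $P_n$ is a lattice point $(x,0)\in P_n$ visited by the path (including the starting point if $S=0$ and the end point $(n,0)$). $Z_n$ is the number of zeros of $P_n$. Here $r$ may depend on $n$; the constant implied in the $O$-term of the conclusion may depend on $\varepsilon$ and on the constant implied in $r=O(n^{1/2-\varepsilon})$. *)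

theory Defs
  imports "HOL-Probability.Probability"
begin

definition is_step :: "int \<times> int \<Rightarrow> int \<times> int \<Rightarrow> bool" where
  "is_step a b \<longleftrightarrow> b - a \<in> {(1, 1), (1, -1)}"

text \<open>A path is represented by the list of lattice points it visits, both end points included.\<close>

definition lattice_paths :: "int \<times> int \<Rightarrow> int \<times> int \<Rightarrow> (int \<times> int) list set" where
  "lattice_paths a b = {p. p \<noteq> [] \<and> hd p = a \<and> last p = b \<and> successively is_step p}"

definition start_heights :: "nat \<Rightarrow> int set" where
  "start_heights n = (\<lambda>k. 2 * int k - int n) ` {0..n}"

definition random_path :: "nat \<Rightarrow> (int \<times> int) list pmf" where
  "random_path n =
     bind_pmf (pmf_of_set (start_heights n)) (\<lambda>S. pmf_of_set (lattice_paths (0, S) (int n, 0)))"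

definition num_zeros :: "(int \<times> int) list \<Rightarrow> nat" where
  "num_zeros p = card {x. (x, 0) \<in> set p}"

text \<open>
  The value of \<^const>\<open>pmf_of_set\<close> is only specified for finite nonempty sets; the following
  facts show that both uses in \<^const>\<open>random_path\<close> are of this kind.
\<close>

lemma finite_start_heights: "finite (start_heights n)"
  and start_heights_nonempty: "start_heights n \<noteq> {}"
  by (auto simp: start_heights_def)

lemma successively_is_step_bounds:
  "successively is_step p \<Longrightarrow> p \<noteq> [] \<Longrightarrow>
     fst (last p) = fst (hd p) + int (length p) - 1 \<and>
     (\<forall>q\<in>set p. q \<in> {fst (hd p)..fst (hd p) + int (length p)} \<times>
                    {snd (hd p) - int (length p)..snd (hd p) + int (length p)})"
proof (induction p)
  case (Cons a p)
  show ?case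
  proof (cases p)
    case (Cons b q)
    with Cons.prems Cons.IH show ?thesis
      by (fastforce simp: is_step_def prod_eq_iff)
  qed (simp add: mem_Times_iff)
qed auto

lemma finite_lattice_paths: "finite (lattice_paths a b)"
proof -
  define l where "l = nat (fst b - fst a + 1)"
  have "lattice_paths a b \<subseteq>
      {p. set p \<subseteq> {fst a..fst a + int l} \<times> {snd a - int l..snd a + int l} \<and> length p = l}"
  proof (intro subsetI CollectI)
    fix p assume "p \<in> lattice_paths a b"
    hence p: "p \<noteq> []" "hd p = a" "last p = b" "successively is_step p"
      by (auto simp: lattice_paths_def)
    note B = successively_is_step_bounds[OF p(4,1), unfolded p(2,3)]
    from B have "length p = l" by (simp add: l_def)
    with B show "set p \<subseteq> {fst a..fst a + int l} \<times> {snd a - int l..snd a + int l} \<and> length p = l"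
      by blast
  qed
  thus ?thesis by (rule finite_subset) (intro finite_lists_length_eq, simp)
qed

lemma lattice_paths_nonempty_aux:
  "\<bar>s\<bar> \<le> int n \<Longrightarrow> even (s + int n) \<Longrightarrow> lattice_paths (c, s) (c + int n, 0) \<noteq> {}"
proof (induction n arbitrary: s c)
  case 0
  hence "[(c, s)] \<in> lattice_paths (c, s) (c + int 0, 0)"
    by (simp add: lattice_paths_def)
  thus ?case by blast
next
  case (Suc n)
  define d :: int where "d = (if s > 0 then -1 else 1)"
  have "\<bar>s + d\<bar> \<le> int n"
  proof (cases "s = 0")
    case True
    with Suc.prems have "n \<noteq> 0" by (cases n) auto
    with True show ?thesis by (simp add: d_def)
  qed (use Suc.prems in \<open>auto simp: d_def\<close>)
  moreover have "even (s + d + int n)" using Suc.prems by (auto simp: d_def)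
  ultimately obtain p where "p \<in> lattice_paths (c + 1, s + d) (c + 1 + int n, 0)"
    using Suc.IH[of "s + d" "c + 1"] by blast
  hence "(c, s) # p \<in> lattice_paths (c, s) (c + int (Suc n), 0)"
    by (cases p) (auto simp: lattice_paths_def is_step_def d_def algebra_simps)
  thus ?case by blast
qed

lemma lattice_paths_nonempty:
  assumes "S \<in> start_heights n"
  shows   "lattice_paths (0, S) (int n, 0) \<noteq> {}"
proof -
  from assms obtain k where "k \<le> n" "S = 2 * int k - int n"
    by (auto simp: start_heights_def)
  thus ?thesis using lattice_paths_nonempty_aux[of S n 0] by (auto simp: abs_le_iff)
qed

end

theory Submission imports Defs begin

text \<open>
  Removing one step from each of the \<open>r - 1\<close> excursions (each of which has two possible signs)
  turns the paths from height \<open>S\<close> with \<open>r\<close> zeros into first-passage paths, so their number is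
  \<open>2 ^ (r - 1)\<close> times a ballot number. Dividing by \<open>n choose m\<close>, where \<open>m = (n - \<bar>S\<bar>) / 2\<close>, gives
  a probability proportional to \<open>(n + r - 1 - 2 * m) * (m choose (r - 1))\<close>, whose sum over \<open>m\<close>
  telescopes. The resulting exact value of \<open>r * (r + 1) * P(Z = r)\<close> is an average of two
  products of factors near 1, whose deviations from 1 have a total of order \<open>r\<^sup>2 / n\<close>.
\<close>

section \<open>First-step recursion for paths and their zeros\<close>

lemma lattice_paths_refl: "lattice_paths a a = {[a]}"
proof (intro equalityI subsetI)
  fix p assume "p \<in> lattice_paths a a"
  then have p: "p \<noteq> []" "hd p = a" "last p = a" "successively is_step p"
    by (auto simp: lattice_paths_def)
  from successively_is_step_bounds[OF p(4,1)] p have "length p = 1" by simp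
  with p show "p \<in> {[a]}" by (cases p) auto
qed (simp add: lattice_paths_def)

lemma lattice_paths_rec:
  assumes "a \<noteq> b"
  shows "lattice_paths a b =
    Cons a ` (lattice_paths (a + (1, 1)) b \<union> lattice_paths (a + (1, -1)) b)"
proof (intro equalityI subsetI)
  fix p assume p: "p \<in> lattice_paths a b"
  then obtain q where q: "p = a # q" by (cases p) (auto simp: lattice_paths_def)
  with p assms obtain c q' where q': "q = c # q'" by (cases q) (auto simp: lattice_paths_def)
  have "c - a = (1, 1) \<or> c - a = (1, -1)"
    using p by (auto simp: lattice_paths_def q q' is_step_def)
  then have "c = a + (1, 1) \<or> c = a + (1, -1)" by (metis add.commute diff_add_cancel)
  moreover have "q \<in> lattice_paths c b" using p by (simp add: lattice_paths_def q q')
  ultimately show "p \<in> Cons a ` (lattice_paths (a + (1, 1)) b \<union> lattice_paths (a + (1, -1)) b)"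
    unfolding q by blast
next
  fix p assume "p \<in> Cons a ` (lattice_paths (a + (1, 1)) b \<union> lattice_paths (a + (1, -1)) b)"
  then obtain q d where q: "p = a # q" "d \<in> {(1, 1), (1, -1)}" "q \<in> lattice_paths (a + d) b"
    by blast
  then have "q \<noteq> []" "is_step a (hd q)" by (simp_all add: lattice_paths_def is_step_def)
  with q show "p \<in> lattice_paths a b"
    by (simp add: lattice_paths_def successively_Cons)
qed

text \<open>Abscissas increase along a path, so \<open>p\<close> does not meet column
  \<open>c\<close>.\<close>

lemma num_zeros_Cons:
  assumes "p \<in> lattice_paths (c + 1, s') b"
  shows "num_zeros ((c, s) # p) = (if s = 0 then Suc (num_zeros p) else num_zeros p)"
proof -
  from assms have p: "p \<noteq> []" "hd p = (c + 1, s')" "successively is_step p"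
    by (auto simp: lattice_paths_def)
  from successively_is_step_bounds[OF p(3,1)] p(2) have "c \<notin> {x. (x, 0) \<in> set p}" by auto
  moreover have "{x. (x, 0) \<in> set ((c, s) # p)} =
      (if s = 0 then insert c {x. (x, 0) \<in> set p} else {x. (x, 0) \<in> set p})"
    by auto
  moreover have "finite {x. (x, 0) \<in> set p}"
    by (rule finite_subset[of _ "fst ` set p"]) force+
  ultimately show ?thesis by (simp add: num_zeros_def)
qed

text \<open>The end point is fixed because dropping the first step keeps it. A predicate
  \<open>P\<close> serves both the total count and the count by zeros, and absorbs the shift caused
  by a zero at the start.\<close>

definition zero_count :: "int \<Rightarrow> nat \<Rightarrow> int \<Rightarrow> (nat \<Rightarrow> bool) \<Rightarrow> nat" where
  "zero_count e n s P = card {p \<in> lattice_paths (e - int n, s) (e, 0). P (num_zeros p)}"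

lemma zero_count_0: "zero_count e 0 s P = (if s = 0 \<and> P 1 then 1 else 0)"
proof (cases "s = 0")
  case True
  have "num_zeros [(e, 0)] = 1" by (simp add: num_zeros_def)
  then have "{p \<in> {[(e, 0)]}. P (num_zeros p)} = (if P 1 then {[(e, 0)]} else {})" by auto
  with True show ?thesis by (simp add: zero_count_def lattice_paths_refl)
next
  case False
  have "lattice_paths (e, s) (e, 0) = {}"
  proof (rule equals0I)
    fix p assume "p \<in> lattice_paths (e, s) (e, 0)"
    then have p: "p \<noteq> []" "hd p = (e, s)" "last p = (e, 0)" "successively is_step p"
      by (auto simp: lattice_paths_def)
    from successively_is_step_bounds[OF p(4,1)] p have "length p = 1" by simp
    with p False show False by (cases p) auto
  qed
  with False show ?thesis by (simp add: zero_count_def)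
qed

lemma zero_count_Suc:
  "zero_count e (Suc n) s P =
     (let Q = (if s = 0 then (\<lambda>r. P (Suc r)) else P)
      in zero_count e n (s + 1) Q + zero_count e n (s - 1) Q)"
proof -
  define c where "c = e - int (Suc n)"
  define Q where "Q = (if s = 0 then (\<lambda>r. P (Suc r)) else P)"
  let ?A = "\<lambda>t. {p \<in> lattice_paths (c + 1, t) (e, 0). Q (num_zeros p)}"
  have c: "c + 1 = e - int n" "(c, s) \<noteq> (e, 0)" by (auto simp: c_def)
  have fin: "finite (?A t)" for t
    by (rule finite_subset[OF _ finite_lattice_paths]) auto
  have "{p \<in> lattice_paths (c, s) (e, 0). P (num_zeros p)} =
      Cons (c, s) ` (?A (s + 1) \<union> ?A (s - 1))"
    unfolding lattice_paths_rec[OF c(2)] by (auto simp: num_zeros_Cons Q_def)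
  then have "zero_count e (Suc n) s P = card (?A (s + 1) \<union> ?A (s - 1))"
    unfolding zero_count_def c_def[symmetric] by (simp add: card_image)
  also have "\<dots> = card (?A (s + 1)) + card (?A (s - 1))"
    by (rule card_Un_disjoint[OF fin fin]) (auto simp: lattice_paths_def)
  finally show ?thesis by (simp add: zero_count_def c Q_def)
qed

text \<open>The end point is always a zero.\<close>

lemma zero_count_eq_0: "zero_count e n s (\<lambda>r. r = 0) = 0"
  by (induction n arbitrary: s)
     (simp_all add: zero_count_0 zero_count_Suc Let_def zero_count_def[of _ _ _ "\<lambda>_. False"])

section \<open>Counting all paths and those with a given number of zeros\<close>

lemma binomial_middle: "Suc n = 2 * k \<Longrightarrow> n choose (k - 1) = n choose k"
  by (subst binomial_symmetric) (auto intro: arg_cong)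

text \<open>Exactly \<open>k\<close> steps have the sign opposite to \<open>s\<close>, and their
  positions determine the path. The induction checks Pascal's rule instead of building this
  bijection.\<close>

lemma card_lattice_paths:
  "int n + \<bar>s\<bar> = 2 * int k \<Longrightarrow> card (lattice_paths (e - int n, s) (e, 0)) = n choose k"
proof -
  have "int n + \<bar>s\<bar> = 2 * int k \<Longrightarrow> zero_count e n s (\<lambda>_. True) = n choose k"
  proof (induction n arbitrary: s k)
    case 0
    then show ?case by (cases k) (auto simp: zero_count_0)
  next
    case (Suc n)
    have k: "k > 0" "int n + (\<bar>s\<bar> + 1) = 2 * int k" "int n + (\<bar>s\<bar> - 1) = 2 * int (k - 1)"
      using Suc.prems by auto
    have up: "zero_count e n s' (\<lambda>_. True) = n choose k" if "\<bar>s'\<bar> = \<bar>s\<bar> + 1" for s'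
      using Suc.IH[of s' k] that k by simp
    have down: "zero_count e n s' (\<lambda>_. True) = n choose (k - 1)" if "\<bar>s'\<bar> = \<bar>s\<bar> - 1" for s'
      using Suc.IH[of s' "k - 1"] that k by simp
    have pascal: "Suc n choose k = (n choose (k - 1)) + (n choose k)"
      using k(1) by (simp add: choose_reduce_nat)
    consider "s = 0" | "s > 0" | "s < 0" by linarith
    then show ?case
    proof cases
      case 1
      \<comment> \<open>At height 0 both neighbours have distance 1 from the axis, giving twice
        \<open>n choose k\<close>; equality of the middle coefficients restores Pascal's
        rule.\<close>
      then have "n choose (k - 1) = n choose k"
        using Suc.prems by (intro binomial_middle) auto
      with 1 pascal show ?thesis by (simp add: zero_count_Suc Let_def up)
    qed (simp_all add: zero_count_Suc Let_def up down pascal)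
  qed
  then show "card (lattice_paths (e - int n, s) (e, 0)) = n choose k" if "int n + \<bar>s\<bar> = 2 * int k"
    using that by (simp add: zero_count_def)
qed

text \<open>The value \<open>-1\<close> in the second equation makes Pascal's rule hold for \<open>k = 0\<close> as well.\<close>

fun ballot :: "nat \<Rightarrow> nat \<Rightarrow> int" where
  "ballot 0 k = (if k = 0 then 1 else 0)"
| "ballot (Suc N) 0 = - 1"
| "ballot (Suc N) (Suc k) = int (N choose k) - int (N choose Suc k)"

lemma ballot_Suc_Suc: "ballot (Suc N) (Suc k) = ballot N k + ballot N (Suc k)"
  by (cases N; cases k) auto

text \<open>The hitting-time form: for \<open>2 * k > N\<close>, among the paths of \<open>N\<close>
  steps from height \<open>2 * k - N\<close> to 0, the proportion \<open>(2 * k - N) / N\<close>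
  reaches 0 only at the end.\<close>

lemma times_ballot:
  "N > 0 \<Longrightarrow> int N * ballot N k = (2 * int k - int N) * int (N choose k)"
proof (induction N k rule: ballot.induct)
  case (3 N k)
  have "int (Suc N) * int (N choose k) = int (Suc k) * int (Suc N choose Suc k)"
    by (metis Suc_times_binomial of_nat_mult)
  then show ?case by (simp add: algebra_simps)
qed auto

text \<open>From a zero, both neighbours have distance 1 from the axis, the same \<open>k\<close>
  and equal counts. So each of the \<open>t\<close> zeros before the end doubles the count and uses
  up one step without changing \<open>k\<close>. Off the axis the count obeys Pascal's rule, as
  \<open>ballot\<close> does.\<close>

lemma zero_count_Suc_zeros:
  "int n + \<bar>s\<bar> = 2 * int k \<Longrightarrow>
     int (zero_count e n s (\<lambda>r. r = Suc t)) = (if t \<le> n then 2 ^ t * ballot (n - t) k else 0)"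
proof (induction n arbitrary: s k t)
  case 0
  then show ?case by (auto simp: zero_count_0)
next
  case (Suc n)
  from Suc.prems obtain k' where k': "k = Suc k'" by (cases k) auto
  have up: "int (zero_count e n s' (\<lambda>r. r = Suc t)) =
      (if t \<le> n then 2 ^ t * ballot (n - t) k else 0)" if "\<bar>s'\<bar> = \<bar>s\<bar> + 1" for s' t
    using Suc.IH[of s' k] that Suc.prems by simp
  have down: "int (zero_count e n s' (\<lambda>r. r = Suc t)) =
      (if t \<le> n then 2 ^ t * ballot (n - t) k' else 0)" if "\<bar>s'\<bar> = \<bar>s\<bar> - 1" for s' t
    using Suc.IH[of s' k'] that Suc.prems k' by simp
  \<comment> \<open>For \<open>t = Suc n\<close> the right side is 0, and so is the left, since
    \<open>ballot 0 k = 0\<close> for positive \<open>k\<close>.\<close>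
  have pascal: "(if t \<le> Suc n then 2 ^ t * ballot (Suc n - t) k else 0) =
      (if t \<le> n then 2 ^ t * ballot (n - t) k else 0) +
      (if t \<le> n then 2 ^ t * ballot (n - t) k' else 0)"
    by (auto simp: Suc_diff_le k' ballot_Suc_Suc algebra_simps le_Suc_eq simp del: ballot.simps(3))
  consider "s = 0" "t = 0" | t' where "s = 0" "t = Suc t'" | "s > 0" | "s < 0"
    by (metis linorder_neqE not0_implies_Suc)
  then show ?case
  proof cases
    case 1
    then have "Suc n = 2 * k" using Suc.prems by auto
    from binomial_middle[OF this] have "n choose k' = n choose k" by (simp add: k')
    with 1 k' show ?thesis by (simp add: zero_count_Suc Let_def zero_count_eq_0)
  next
    case 2
    then show ?thesis by (simp add: zero_count_Suc Let_def up)
  next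
    case 3
    then show ?thesis unfolding pascal by (simp add: zero_count_Suc Let_def up down)
  next
    case 4
    then show ?thesis unfolding pascal by (simp add: zero_count_Suc Let_def up down)
  qed
qed

section \<open>Distribution of the number of zeros for a fixed start\<close>

lemma prob_bind_pmf_of_set:
  assumes "finite A" "A \<noteq> {}" "\<And>x. x \<in> A \<Longrightarrow> finite (set_pmf (f x))"
  shows "measure_pmf.prob (bind_pmf (pmf_of_set A) f) X =
    (\<Sum>x\<in>A. measure_pmf.prob (f x) X) / real (card A)"
  using pmf_expectation_bind_pmf_of_set[of A f "indicat_real X"] assms
  by (simp add: sum_distrib_left divide_inverse_commute)

lemma card_start_heights: "card (start_heights n) = Suc n"
  unfolding start_heights_def by (subst card_image) (auto simp: inj_on_def)

text \<open>\<open>m\<close> counts the steps with the same sign as the start height. The quotient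
  of path counts is rewritten so that \<open>m\<close> occurs only in a linear factor and in
  \<open>m choose t\<close>, which makes it summable over \<open>m\<close>.\<close>

lemma prob_lattice_paths_zeros:
  assumes "k \<le> n" "t < n"
  defines "m \<equiv> min k (n - k)"
  shows "measure_pmf.prob (pmf_of_set (lattice_paths (0, 2 * int k - int n) (int n, 0)))
           {p. num_zeros p = Suc t} =
    2 ^ t * (real n + real t - 2 * real m) * real (m choose t) /
      ((real n - real t) * real (n choose t))"
proof -
  define s where "s = 2 * int k - int n"
  have m: "m \<le> n" "int n + \<bar>s\<bar> = 2 * int (n - m)"
    using assms(1) by (auto simp: m_def s_def min_def)
  let ?L = "lattice_paths (0, s) (int n, 0)"
  have "s \<in> start_heights n" using assms(1) by (auto simp: s_def start_heights_def)
  then have L: "finite ?L" "?L \<noteq> {}" by (simp_all add: finite_lattice_paths lattice_paths_nonempty)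
  have "int (card (?L \<inter> {p. num_zeros p = Suc t})) = 2 ^ t * ballot (n - t) (n - m)"
    using zero_count_Suc_zeros[OF m(2), of "int n" t] assms(2)
    by (simp add: zero_count_def Int_def)
  from arg_cong[OF this, of real_of_int]
  have num: "real (card (?L \<inter> {p. num_zeros p = Suc t})) = 2 ^ t * of_int (ballot (n - t) (n - m))"
    by simp
  have den: "card ?L = n choose m"
    using card_lattice_paths[OF m(2), of "int n"] m(1) by (simp add: binomial_symmetric[of m n])
  have "real (n - t) * of_int (ballot (n - t) (n - m)) =
      (2 * real (n - m) - real (n - t)) * real ((n - t) choose (n - m))"
    using arg_cong[OF times_ballot[of "n - t" "n - m"], of real_of_int] assms(2) by simp
  then have B: "(real n - real t) * of_int (ballot (n - t) (n - m)) =
      (real n + real t - 2 * real m) * real ((n - t) choose (n - m))"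
    using assms(2) m(1) by (simp add: of_nat_diff algebra_simps)
  \<comment> \<open>Choosing \<open>m\<close> out of \<open>n\<close> and then \<open>t\<close> of
    these amounts to choosing the \<open>t\<close> first; for \<open>t > m\<close> both sides
    vanish.\<close>
  have C: "((n - t) choose (n - m)) * (n choose t) = (n choose m) * (m choose t)"
  proof (cases "t \<le> m")
    case True
    then have "(n - t) choose (n - m) = (n - t) choose (m - t)"
      using m(1) by (subst binomial_symmetric) auto
    with choose_mult[OF True m(1)] show ?thesis by simp
  next
    case False
    then have "m choose t = 0" "(n - t) choose (n - m) = 0"
      using m(1) assms(2) by (intro binomial_eq_0; linarith)+
    then show ?thesis by (simp only: mult_0 mult_0_right)
  qed
  have pos: "real n - real t > 0" "real (n choose t) > 0" "real (n choose m) > 0"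
    using assms(2) m(1) by auto
  have "(2 ^ t * of_int (ballot (n - t) (n - m))) * ((real n - real t) * real (n choose t)) =
      2 ^ t * ((real n - real t) * of_int (ballot (n - t) (n - m))) * real (n choose t)"
    by (simp add: algebra_simps)
  also have "\<dots> = 2 ^ t * (real n + real t - 2 * real m) *
      real (((n - t) choose (n - m)) * (n choose t))"
    unfolding B by (simp add: algebra_simps)
  also have "\<dots> = 2 ^ t * (real n + real t - 2 * real m) * real (m choose t) * real (n choose m)"
    unfolding C by (simp add: algebra_simps)
  finally have "2 ^ t * of_int (ballot (n - t) (n - m)) / real (n choose m) =
      2 ^ t * (real n + real t - 2 * real m) * real (m choose t) /
        ((real n - real t) * real (n choose t))"
    using pos by (subst frac_eq_eq) auto
  then show ?thesis
    unfolding s_def[symmetric] measure_pmf_of_set[OF L(2,1)] num den .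
qed

section \<open>Summation over the starting heights\<close>

lemma sum_min_symmetric:
  fixes g :: "nat \<Rightarrow> real"
  shows "(\<Sum>k\<le>n. g (min k (n - k))) = (\<Sum>m<Suc (n div 2). g m) + (\<Sum>m<Suc n div 2. g m)"
proof -
  \<comment> \<open>\<open>k\<close> and \<open>n - k\<close> give the same minimum, so the range is
    folded at its middle; for even \<open>n\<close> the central \<open>k\<close> belongs to the
    first half only, hence two different bounds.\<close>
  have split: "{..n} = {..<Suc (n div 2)} \<union> (\<lambda>m. n - m) ` {..<Suc n div 2}"
    (is "_ = ?A \<union> ?f ` ?B")
  proof (intro equalityI subsetI)
    fix k assume k: "k \<in> {..n}"
    show "k \<in> ?A \<union> ?f ` ?B"
    proof (cases "k \<le> n div 2")
      case False
      then have "k = ?f (n - k)" "n - k \<in> ?B" using k by auto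
      then show ?thesis by blast
    qed simp
  qed auto
  have disj: "?A \<inter> ?f ` ?B = {}" by auto
  have inj: "inj_on ?f ?B" by (auto simp: inj_on_def)
  have "(\<Sum>k\<le>n. g (min k (n - k))) =
      (\<Sum>k\<in>?A. g (min k (n - k))) + (\<Sum>k\<in>?f ` ?B. g (min k (n - k)))"
    unfolding split by (intro sum.union_disjoint disj) auto
  also have "(\<Sum>k\<in>?f ` ?B. g (min k (n - k))) = (\<Sum>m\<in>?B. g (min (n - m) (n - (n - m))))"
    by (subst sum.reindex[OF inj]) simp
  also have "(\<Sum>k\<in>?A. g (min k (n - k))) = (\<Sum>k\<in>?A. g k)"
  proof (rule sum.cong)
    fix k assume "k \<in> ?A"
    then have "min k (n - k) = k" by (simp only: lessThan_iff)
    then show "g (min k (n - k)) = g k" by simp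
  qed simp
  also have "(\<Sum>m\<in>?B. g (min (n - m) (n - (n - m)))) = (\<Sum>m\<in>?B. g m)"
  proof (rule sum.cong)
    fix m assume "m \<in> ?B"
    then have "min (n - m) (n - (n - m)) = m" by (simp only: lessThan_iff)
    then show "g (min (n - m) (n - (n - m))) = g m" by simp
  qed simp
  finally show ?thesis .
qed

text \<open>The right side vanishes at \<open>M = 0\<close> and its increments are the summands
  times \<open>t + 2\<close>, a factor that clears denominators.\<close>

lemma sum_linear_times_choose:
  fixes x :: real
  shows "(real t + 2) * (\<Sum>m<M. (x + real t - 2 * real m) * real (m choose t)) =
    real (M choose Suc t) * ((real t + 2) * (x - real t) - 2 * (real t + 1) * (real M - 1 - real t))"
proof (induction M)
  case (Suc M)
  \<comment> \<open>The increment contains a multiple of \<open>M choose Suc t\<close>; absorption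
    converts it to \<open>M choose t\<close>, the binomial of the summand.\<close>
  have absorb: "(real t + 1) * real (M choose Suc t) = (real M - real t) * real (M choose t)"
  proof (cases "t \<le> M")
    case True
    have "Suc t * (M choose Suc t) = (M - t) * (M choose t)"
      by (metis binomial_absorb_comp binomial_absorption)
    from arg_cong[OF this, of real] True show ?thesis
      by (simp add: of_nat_diff algebra_simps)
  next
    case False
    then show ?thesis by (simp add: binomial_eq_0)
  qed
  have "real (Suc M choose Suc t) * ((real t + 2) * (x - real t) -
        2 * (real t + 1) * (real (Suc M) - 1 - real t)) =
      real (M choose Suc t) * ((real t + 2) * (x - real t) - 2 * (real t + 1) * (real M - 1 - real t))
      - 2 * ((real t + 1) * real (M choose Suc t))
      + real (M choose t) * ((real t + 2) * (x - real t) - 2 * (real t + 1) * (real M - real t))"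
    by (simp add: algebra_simps)
  also have "\<dots> = (real t + 2) * (\<Sum>m<Suc M. (x + real t - 2 * real m) * real (m choose t))"
    unfolding absorb using Suc.IH by (simp add: algebra_simps)
  finally show ?case by simp
qed simp

text \<open>For \<open>0 < r < n\<close> this is \<open>2 * r * (r + 1) / (n + 1)\<close> times the
  sum over \<open>m < M\<close> of the probabilities for fixed starts, arranged in factors near 1
  when \<open>2 * M\<close> is near \<open>n\<close> and \<open>r ^ 2\<close> is small against
  \<open>n\<close>.\<close>

definition zeros_factor :: "nat \<Rightarrow> nat \<Rightarrow> nat \<Rightarrow> real" where
  "zeros_factor n r M = 2 ^ r * real (M choose r) / real (n choose r) *
     (1 + (real r ^ 2 + real r * (real n - 2 * real M)) / (real n + 1))"

lemma prob_num_zeros: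
  assumes "0 < r" "r < n"
  shows "measure_pmf.prob (random_path n) {p. num_zeros p = r} =
    (zeros_factor n r (Suc (n div 2)) + zeros_factor n r (Suc n div 2)) / 2 / (real r * (real r + 1))"
proof -
  from assms obtain t where t: "r = Suc t" "t < n" by (cases r) auto
  define g where "g m = 2 ^ t * (real n + real t - 2 * real m) * real (m choose t) /
      ((real n - real t) * real (n choose t))" for m
  have "measure_pmf.prob (random_path n) {p. num_zeros p = r} =
      (\<Sum>S\<in>start_heights n. measure_pmf.prob (pmf_of_set (lattice_paths (0, S) (int n, 0)))
         {p. num_zeros p = r}) / real (card (start_heights n))"
    unfolding random_path_def
    by (intro prob_bind_pmf_of_set finite_start_heights start_heights_nonempty)
       (simp add: finite_lattice_paths lattice_paths_nonempty)
  also have "(\<Sum>S\<in>start_heights n. measure_pmf.prob (pmf_of_set (lattice_paths (0, S) (int n, 0)))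
         {p. num_zeros p = r}) =
      (\<Sum>k\<le>n. measure_pmf.prob (pmf_of_set (lattice_paths (0, 2 * int k - int n) (int n, 0)))
         {p. num_zeros p = r})"
    unfolding start_heights_def
    by (subst sum.reindex) (auto simp: inj_on_def atLeast0AtMost)
  also have "\<dots> = (\<Sum>k\<le>n. g (min k (n - k)))"
    unfolding t(1) g_def by (intro sum.cong prob_lattice_paths_zeros t(2)) auto
  also have "\<dots> = (\<Sum>m<Suc (n div 2). g m) + (\<Sum>m<Suc n div 2. g m)"
    by (rule sum_min_symmetric)
  also have "card (start_heights n) = Suc n" by (rule card_start_heights)
  finally have P: "measure_pmf.prob (random_path n) {p. num_zeros p = r} =
      ((\<Sum>m<Suc (n div 2). g m) + (\<Sum>m<Suc n div 2. g m)) / real (Suc n)" .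
  have S: "(\<Sum>m<M. g m) / real (Suc n) = zeros_factor n r M / 2 / (real r * (real r + 1))" for M
  proof -
    define b where "b = (real t + 2) * (real n - real t) - 2 * (real t + 1) * (real M - 1 - real t)"
    have "Suc t * (n choose Suc t) = (n - t) * (n choose t)"
      by (metis binomial_absorb_comp binomial_absorption)
    from arg_cong[OF this, of real] t(2)
    have nt: "(real n - real t) * real (n choose t) = real r * real (n choose r)"
      by (simp add: t(1) of_nat_diff algebra_simps)
    have "(\<Sum>m<M. g m) = 2 ^ t / ((real n - real t) * real (n choose t)) *
        (\<Sum>m<M. (real n + real t - 2 * real m) * real (m choose t))"
      by (simp add: g_def sum_distrib_left mult_ac)
    also have "(\<Sum>m<M. (real n + real t - 2 * real m) * real (m choose t)) =
        real (M choose r) * b / (real r + 1)"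
      using sum_linear_times_choose[of t "real n" M]
      by (simp add: b_def t(1) field_simps)
    finally have "(\<Sum>m<M. g m) / real (Suc n) =
        2 ^ t * real (M choose r) / real (n choose r) * (b / (real n + 1)) / (real r * (real r + 1))"
      unfolding nt by (simp add: mult_ac)
    also have "b / (real n + 1) = 1 + (real r ^ 2 + real r * (real n - 2 * real M)) / (real n + 1)"
      by (simp add: b_def t(1) field_simps power2_eq_square)
    also have "2 ^ t = 2 ^ r / (2 :: real)" by (simp add: t(1))
    finally show ?thesis by (simp add: zeros_factor_def)
  qed
  show ?thesis unfolding P add_divide_distrib S ..
qed

section \<open>Estimates for products of factors near 1\<close>

lemma abs_prod_minus_1_le:
  fixes f :: "nat \<Rightarrow> real"
  assumes "(\<Sum>i\<in>A. \<bar>f i\<bar>) \<le> 1"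
  shows "\<bar>(\<Prod>i\<in>A. 1 + f i) - 1\<bar> \<le> 2 * (\<Sum>i\<in>A. \<bar>f i\<bar>)"
proof -
  let ?y = "\<Sum>i\<in>A. \<bar>f i\<bar>"
  have y: "0 \<le> ?y" by (rule sum_nonneg) auto
  have "\<bar>(\<Prod>i\<in>A. 1 + f i) - 1\<bar> \<le> (\<Prod>i\<in>A. 1 + \<bar>f i\<bar>) - 1"
    using norm_prod_minus1_le_prod_minus1[of f A] by simp
  also have "\<dots> \<le> exp ?y - 1" using prod_le_exp_sum[of A "\<lambda>i. \<bar>f i\<bar>"] by simp
  \<comment> \<open>The bound \<open>?y \<le> 1\<close> enters here for \<open>exp\<close> and again
    below to replace the square by \<open>?y\<close>.\<close>
  also have "\<dots> \<le> ?y + ?y\<^sup>2" using exp_bound[OF y assms] by simp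
  also have "\<dots> \<le> ?y + ?y" using y assms by (simp add: power2_eq_square mult_left_le)
  finally show ?thesis by simp
qed

text \<open>Each of \<open>r\<close> ratios deviates from 1 by at most \<open>4 * r / n\<close>, and
  the last factor by at most \<open>r ^ 2 / n\<close>. The total is at most
  \<open>5 * r ^ 2 / n\<close>, which is at most 1 by hypothesis, and the product bound doubles
  it.\<close>

lemma zeros_factor_approx:
  assumes "0 < r" "5 * r ^ 2 \<le> n" and "n \<le> 2 * M" "2 * M \<le> n + 2"
  shows "\<bar>zeros_factor n r M - 1\<bar> \<le> 10 * (real r ^ 2 / real n)"
proof -
  have M: "\<bar>2 * real M - real n - 1\<bar> \<le> 1" using assms(3,4) by linarith
  \<comment> \<open>Below \<open>r\<close> these are the deviations of the ratios
    \<open>2 * (M - j) / (n - j)\<close> from the quotient of binomials; index \<open>r\<close>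
    holds that of the remaining factor.\<close>
  define f where "f j = (if j < r then (2 * real M - real n - real j) / (real n - real j)
      else (real r ^ 2 + real r * (real n - 2 * real M)) / (real n + 1))" for j
  have "r * 1 \<le> r * r" using assms(1) by (intro mult_left_mono) auto
  then have r2: "r \<le> r ^ 2" by (simp add: power2_eq_square)
  then have rn: "5 * r \<le> n" using assms(2) by linarith
  have n: "n > 0" using rn assms(1) by simp
  have "real (5 * r ^ 2) \<le> real n" using assms(2) by (rule of_nat_mono)
  then have r2n: "5 * real r ^ 2 \<le> real n" by simp
  have binom: "real (m choose r) = (\<Prod>j<r. real m - real j) / fact r" for m
    by (simp add: binomial_gbinomial gbinomial_prod_rev lessThan_atLeast0)
  have "(\<Prod>j<r. 2 * (real M - real j) / (real n - real j)) =
      2 ^ r * (\<Prod>j<r. real M - real j) / (\<Prod>j<r. real n - real j)"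
    by (simp only: prod_dividef prod.distrib prod_constant card_lessThan)
  then have "2 ^ r * real (M choose r) / real (n choose r) =
      (\<Prod>j<r. 2 * (real M - real j) / (real n - real j))"
    unfolding binom by simp
  also have "\<dots> = (\<Prod>j<r. 1 + f j)"
    using rn by (intro prod.cong) (auto simp: f_def field_simps)
  finally have eq: "zeros_factor n r M = (\<Prod>j<Suc r. 1 + f j)"
    by (simp add: zeros_factor_def f_def)
  have "\<bar>f j\<bar> \<le> 4 * real r / real n" if "j < r" for j
  proof -
    have "\<bar>2 * real M - real n - real j\<bar> \<le> 2 * real r"
      using M that assms(1) by linarith
    moreover have "real n / 2 \<le> real n - real j" "0 < real n - real j"
      using that rn by linarith+
    ultimately have "\<bar>2 * real M - real n - real j\<bar> / \<bar>real n - real j\<bar> \<le> (2 * real r) / (real n / 2)"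
      using n by (intro frac_le) auto
    then have "\<bar>f j\<bar> \<le> (2 * real r) / (real n / 2)"
      using that by (simp only: f_def abs_divide if_True)
    then show ?thesis by simp
  qed
  then have "(\<Sum>j<r. \<bar>f j\<bar>) \<le> (\<Sum>j<r. 4 * real r / real n)"
    by (intro sum_mono) auto
  also have "\<dots> = 4 * (real r ^ 2 / real n)" by (simp add: power2_eq_square)
  finally have 1: "(\<Sum>j<r. \<bar>f j\<bar>) \<le> 4 * (real r ^ 2 / real n)" .
  \<comment> \<open>The numerator lies between \<open>r ^ 2 - 2 * r\<close> and
    \<open>r ^ 2\<close>; the lower end is at least \<open>- (r ^ 2)\<close> because
    \<open>r \<le> r ^ 2\<close>.\<close>
  have "real r \<le> real r ^ 2" using r2 by (metis of_nat_mono of_nat_power)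
  moreover have "\<bar>real r * (real n + 1 - 2 * real M)\<bar> \<le> real r * 1"
    unfolding abs_mult using M by (intro mult_mono) auto
  moreover have "real r * (real n - 2 * real M) = real r * (real n + 1 - 2 * real M) - real r"
    by (simp add: algebra_simps)
  ultimately have "\<bar>real r ^ 2 + real r * (real n - 2 * real M)\<bar> \<le> real r ^ 2"
    by linarith
  then have "\<bar>real r ^ 2 + real r * (real n - 2 * real M)\<bar> / \<bar>real n + 1\<bar> \<le> real r ^ 2 / real n"
    using n by (intro frac_le) auto
  then have "\<bar>f r\<bar> \<le> real r ^ 2 / real n"
    by (simp only: f_def abs_divide less_irrefl if_False)
  with 1 have sum: "(\<Sum>j<Suc r. \<bar>f j\<bar>) \<le> 5 * (real r ^ 2 / real n)" by simp
  also have "\<dots> \<le> 1" using r2n n by (simp add: field_simps)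
  finally have "(\<Sum>j<Suc r. \<bar>f j\<bar>) \<le> 1" .
  from abs_prod_minus_1_le[OF this] sum show ?thesis unfolding eq by linarith
qed

text \<open>Both values of \<open>M\<close> satisfy \<open>n \<le> 2 * M \<le> n + 2\<close>, and
  \<open>\<delta>\<close> is the average of the two factors minus 1.\<close>

lemma prob_num_zeros_approx:
  assumes "0 < r" "5 * r ^ 2 \<le> n"
  shows "\<exists>\<delta>. \<bar>\<delta>\<bar> \<le> 10 * (real r ^ 2 / real n) \<and>
    measure_pmf.prob (random_path n) {p. num_zeros p = r} = 1 / (real r * (real r + 1)) * (1 + \<delta>)"
proof -
  have "r * 1 \<le> r * r" using assms(1) by (intro mult_left_mono) auto
  then have "r \<le> r ^ 2" by (simp add: power2_eq_square)
  then have "r < n" using assms by linarith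
  have half: "n \<le> 2 * Suc (n div 2)" "2 * Suc (n div 2) \<le> n + 2"
    "n \<le> 2 * (Suc n div 2)" "2 * (Suc n div 2) \<le> n + 2"
    by simp_all
  define x y where "x = zeros_factor n r (Suc (n div 2))" and "y = zeros_factor n r (Suc n div 2)"
  have "\<bar>x - 1\<bar> \<le> 10 * (real r ^ 2 / real n)" "\<bar>y - 1\<bar> \<le> 10 * (real r ^ 2 / real n)"
    unfolding x_def y_def by (intro zeros_factor_approx assms half)+
  then have "\<bar>(x + y) / 2 - 1\<bar> \<le> 10 * (real r ^ 2 / real n)"
    unfolding abs_le_iff by argo
  with prob_num_zeros[OF assms(1) \<open>r < n\<close>] show ?thesis
    by (intro exI[of _ "(x + y) / 2 - 1"]) (simp add: x_def y_def)
qed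

text \<open>\<open>C\<close> and \<open>K\<close> are the constants implied in the hypothesis on
  \<open>r\<close> and in the conclusion. Quantifying over all \<open>r\<close> after
  \<open>n\<close> makes the estimate uniform, so \<open>r\<close> may depend on
  \<open>n\<close>.\<close>

theorem theorem5p3:
  fixes \<epsilon> C :: real
  assumes "0 < \<epsilon>" and "\<epsilon> \<le> 1 / 2"
  shows "\<exists>K. \<forall>\<^sub>F n in sequentially. \<forall>r::nat. 0 < r \<longrightarrow> real r \<le> C * real n powr (1 / 2 - \<epsilon>) \<longrightarrow>
           (\<exists>\<delta>. \<bar>\<delta>\<bar> \<le> K * (1 / real n powr (2 * \<epsilon>)) \<and>
                measure_pmf.prob (random_path n) {p. num_zeros p = r} =
                  1 / (real r * (real r + 1)) * (1 + \<delta>))"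
proof (intro exI)
  \<comment> \<open>Since \<open>r ^ 2 / n\<close> is at most
    \<open>C\<^sup>2 * n powr (- (2 * \<epsilon>))\<close>, this limit yields
    \<open>5 * r ^ 2 \<le> n\<close> for large \<open>n\<close>; the same bound leads to
    \<open>K = 10 * C\<^sup>2\<close>.\<close>
  have "((\<lambda>n. 5 * C\<^sup>2 * real n powr (- (2 * \<epsilon>))) \<longlongrightarrow> 5 * C\<^sup>2 * 0) sequentially"
    using assms(1)
    by (intro tendsto_intros tendsto_neg_powr filterlim_real_sequentially) auto
  then have "\<forall>\<^sub>F n in sequentially. 5 * C\<^sup>2 * real n powr (- (2 * \<epsilon>)) < 1"
    by (rule order_tendstoD) simp
  then show "\<forall>\<^sub>F n in sequentially. \<forall>r::nat. 0 < r \<longrightarrow> real r \<le> C * real n powr (1 / 2 - \<epsilon>) \<longrightarrow>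
           (\<exists>\<delta>. \<bar>\<delta>\<bar> \<le> 10 * C\<^sup>2 * (1 / real n powr (2 * \<epsilon>)) \<and>
                measure_pmf.prob (random_path n) {p. num_zeros p = r} =
                  1 / (real r * (real r + 1)) * (1 + \<delta>))"
    using eventually_gt_at_top[of 0]
  proof (eventually_elim, intro allI impI)
    fix n r :: nat
    assume small: "5 * C\<^sup>2 * real n powr (- (2 * \<epsilon>)) < 1" and n: "0 < n"
      and r: "0 < r" "real r \<le> C * real n powr (1 / 2 - \<epsilon>)"
    have "real r ^ 2 \<le> (C * real n powr (1 / 2 - \<epsilon>)) ^ 2"
      using r by (intro power_mono) auto
    also have "\<dots> = C\<^sup>2 * real n powr (1 - 2 * \<epsilon>)"
      by (simp add: power_mult_distrib power2_eq_square[of "_ powr _"] flip: powr_add)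
    also have "real n powr (1 - 2 * \<epsilon>) = real n * real n powr (- (2 * \<epsilon>))"
      using n by (simp add: powr_diff powr_minus_divide)
    finally have bound: "real r ^ 2 / real n \<le> C\<^sup>2 * real n powr (- (2 * \<epsilon>))"
      using n by (simp add: field_simps)
    with small have "5 * (real r ^ 2 / real n) \<le> 1" by linarith
    then have "real (5 * r ^ 2) \<le> real n" using n by (simp add: field_simps)
    then have "5 * r ^ 2 \<le> n" by (rule of_nat_le_iff[THEN iffD1])
    from prob_num_zeros_approx[OF r(1) this] obtain \<delta> where
      "\<bar>\<delta>\<bar> \<le> 10 * (real r ^ 2 / real n)"
      "measure_pmf.prob (random_path n) {p. num_zeros p = r} = 1 / (real r * (real r + 1)) * (1 + \<delta>)"
      by blast
    moreover from this(1) bound have "\<bar>\<delta>\<bar> \<le> 10 * C\<^sup>2 * (1 / real n powr (2 * \<epsilon>))"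
      by (simp add: powr_minus_divide)
    ultimately show "\<exists>\<delta>. \<bar>\<delta>\<bar> \<le> 10 * C\<^sup>2 * (1 / real n powr (2 * \<epsilon>)) \<and>
        measure_pmf.prob (random_path n) {p. num_zeros p = r} =
          1 / (real r * (real r + 1)) * (1 + \<delta>)"
      by blast
  qed
qed

end
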